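(* Let $n\ge1$ and $e,k\ge0$. There is a bijection between the set of bi-increasing permutations $\pi\in{\cal S}_n$ with ${\sf exc}(\pi)=e$ and ${\sf dexc}(\pi)=k$ and the set of step polyominoes of width $e+1$, height $n+1$ and area $k+n+1$.
   Context: Permutations $\pi\in{\cal S}_n$ are written as words $\pi_1\cdots\pi_n$. An excedance of $\pi$ is an integer $i\in[n-1]$ with $\pi_i>i$; ${\sf E}(\pi)$ is the set of excedances, ${\sf exc}(\pi)=|{\sf E}(\pi)|$, ${\sf dexc}(\pi)=\sum_{i\in{\sf E}(\pi)}(\pi_i-i)$, and ${\sf inv}(\pi)$ is the number of pairs $i<j$ with $\pi_i>\pi_j$. A permutation is bi-increasing if ${\sf inv}(\pi)={\sf dexc}(\pi)$. A parallelogram polyomino is a finite union of unit cells of the plane bounded by two lattice paths that start at the origin, use only unit steps north $[0,1]$ and east $[1,0]$, end at a common point, and meet only at their start and end points. Its width and height are the coordinates of the common end point, its perimeter is the total boundary length, and its area is its number of cells. A step polyomino is a parallelogram polyomino in which every horizontal boundary segment has length $1$, i.e. neither boundary path contains two consecutive east steps. *)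

theory Defs
  imports "HOL-Combinatorics.Permutations"
begin

text \<open>
  Permutations in \<open>S\<^sub>n\<close> are functions \<open>p :: nat \<Rightarrow> nat\<close> with \<open>p permutes {1..n}\<close>
  (in particular they are the identity outside \<open>{1..n}\<close>, so distinct words give
  distinct functions and conversely).
\<close>

definition excedances :: "nat \<Rightarrow> (nat \<Rightarrow> nat) \<Rightarrow> nat set" where
  "excedances n p = {i \<in> {1..n - 1}. p i > i}"

definition exc :: "nat \<Rightarrow> (nat \<Rightarrow> nat) \<Rightarrow> nat" where
  "exc n p = card (excedances n p)"

definition dexc :: "nat \<Rightarrow> (nat \<Rightarrow> nat) \<Rightarrow> nat" where
  "dexc n p = (\<Sum>i\<in>excedances n p. p i - i)"

definition inv_number :: "nat \<Rightarrow> (nat \<Rightarrow> nat) \<Rightarrow> nat" where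
  "inv_number n p = card {(i, j). 1 \<le> i \<and> i < j \<and> j \<le> n \<and> p i > p j}"

definition bi_increasing :: "nat \<Rightarrow> (nat \<Rightarrow> nat) \<Rightarrow> bool" where
  "bi_increasing n p \<longleftrightarrow> p permutes {1..n} \<and> inv_number n p = dexc n p"

datatype step = North | East

type_synonym lattice_path = "step list"

definition end_point :: "lattice_path \<Rightarrow> nat \<times> nat" where
  "end_point w = (count_list w East, count_list w North)"

definition path_points :: "lattice_path \<Rightarrow> (nat \<times> nat) set" where
  "path_points w = {end_point (take m w) | m. m \<le> length w}"

definition east_step_at :: "lattice_path \<Rightarrow> nat \<Rightarrow> nat \<Rightarrow> bool" where
  "east_step_at w x y \<longleftrightarrow> (\<exists>m < length w. w ! m = East \<and> end_point (take m w) = (x, y))"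

text \<open>
  The pair \<open>(u, l)\<close> consists of the upper and the lower boundary path. Unit-step lattice
  paths that share no edge can only meet in lattice points, so it suffices to compare
  these. The conditions on the first steps say which of the two paths is the upper one;
  they also exclude the degenerate pairs in which both paths are empty or both are the
  same single step.
\<close>

definition boundary_pair :: "lattice_path \<Rightarrow> lattice_path \<Rightarrow> bool" where
  "boundary_pair u l \<longleftrightarrow>
     u \<noteq> [] \<and> l \<noteq> [] \<and> hd u = North \<and> hd l = East \<and>
     end_point u = end_point l \<and>
     path_points u \<inter> path_points l = {(0, 0), end_point u}"

text \<open>
  The unit cell with lower left corner \<open>(x, y)\<close> is represented by \<open>(x, y)\<close>, and a union of
  cells by its set of cells. A cell lies between the paths iff, in its column, the east
  step of the lower path is weakly below its bottom side and the east step of the upper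
  path is weakly above its top side.
\<close>

definition cells_between :: "lattice_path \<Rightarrow> lattice_path \<Rightarrow> (nat \<times> nat) set" where
  "cells_between u l =
     {(x, y). (\<exists>b. east_step_at l x b \<and> b \<le> y) \<and> (\<exists>t. east_step_at u x t \<and> y + 1 \<le> t)}"

definition bounds_polyomino ::
    "lattice_path \<Rightarrow> lattice_path \<Rightarrow> (nat \<times> nat) set \<Rightarrow> bool" where
  "bounds_polyomino u l P \<longleftrightarrow> boundary_pair u l \<and> P = cells_between u l"

definition no_consecutive_easts :: "lattice_path \<Rightarrow> bool" where
  "no_consecutive_easts w \<longleftrightarrow> \<not> (\<exists>m. m + 1 < length w \<and> w ! m = East \<and> w ! (m + 1) = East)"

definition step_polyominoes :: "nat \<Rightarrow> nat \<Rightarrow> nat \<Rightarrow> (nat \<times> nat) set set" where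
  "step_polyominoes width height area =
     {P. \<exists>u l. bounds_polyomino u l P \<and>
           no_consecutive_easts u \<and> no_consecutive_easts l \<and>
           end_point u = (width, height) \<and> card P = area}"

end

theory Submission imports Defs "HOL-Library.Infinite_Set" begin

text \<open>
  Counting the inversions of \<open>\<pi>\<close> by their first entry gives \<open>dexc\<close> plus the number of inversions
  whose second position is an excedance plus the number of those whose first position is not one.
  Hence \<open>\<pi>\<close> is bi-increasing iff it is increasing both on its set \<open>B\<close> of excedances and on the
  complement, and so it is determined by \<open>B\<close> and the set \<open>T\<close> of excedance values. The pairs
  \<open>(B, T)\<close> that occur are those in which the \<open>i\<close>-th smallest element of \<open>B\<close> is less than the
  \<open>i\<close>-th smallest element of \<open>T\<close>, for all \<open>i\<close>. On the other side, a boundary path of a step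
  polyomino is determined by the heights of its east steps; these are \<open>{0} \<union> B\<close> for the lower and
  \<open>T \<union> {n + 1}\<close> for the upper path, and the same condition on \<open>(B, T)\<close> says that the paths do not
  meet. Row \<open>y\<close> of the polyomino has one cell more than there are excedances \<open>i \<le> y < \<pi>\<^sub>i\<close>, so the
  area is \<open>dexc \<pi> + n + 1\<close>.
\<close>

section \<open>Rank functions of sets of natural numbers\<close>

text \<open>On elements of \<open>A\<close> this is the zero-based position in increasing order. For
  a path with east steps at the heights \<open>A\<close>, it is the abscissa at which the path
  arrives at height \<open>y\<close>.\<close>

definition rank :: "nat set \<Rightarrow> nat \<Rightarrow> nat" where
  "rank A y = card (A \<inter> {..<y})"

lemma rank_0 [simp]: "rank A 0 = 0"
  by (simp add: rank_def)

lemma rank_Suc: "rank A (Suc y) = rank A y + (if y \<in> A then 1 else 0)"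
  by (simp add: rank_def lessThan_Suc)

lemma mono_rank: "x \<le> y \<Longrightarrow> rank A x \<le> rank A y"
  unfolding rank_def by (intro card_mono) auto

lemma rank_eq_card: "A \<subseteq> {..<y} \<Longrightarrow> rank A y = card A"
  by (simp add: rank_def Int_absorb2)

lemma rank_less_iff: "a \<in> A \<Longrightarrow> rank A a < rank A y \<longleftrightarrow> a < y"
  using mono_rank[of "Suc a" y A] mono_rank[of y a A] by (cases "a < y") (auto simp: rank_Suc)

lemma rank_inject: "a \<in> A \<Longrightarrow> b \<in> A \<Longrightarrow> rank A a = rank A b \<longleftrightarrow> a = b"
  using rank_less_iff[of a A b] rank_less_iff[of b A a] by linarith

text \<open>Passing from \<open>y\<close> to \<open>Suc y\<close> adds the single new rank
  \<open>rank A y\<close>, and only if \<open>y\<close> lies in \<open>A\<close>; so ranks are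
  attained without gaps. This locates the east step in column \<open>x\<close>.\<close>

lemma ex_rank_eq_iff: "(\<exists>a\<in>A. a < y \<and> rank A a = x) \<longleftrightarrow> x < rank A y"
proof (induction y)
  case (Suc y)
  have "(\<exists>a\<in>A. a < Suc y \<and> rank A a = x) \<longleftrightarrow> (\<exists>a\<in>A. a < y \<and> rank A a = x) \<or> (y \<in> A \<and> rank A y = x)"
    by (auto simp: less_Suc_eq)
  then show ?case
    unfolding Suc by (auto simp: rank_Suc)
qed simp

lemma ex_rank_eq_ge_iff:
  "(\<exists>a\<in>A. y \<le> a \<and> a < z \<and> rank A a = x) \<longleftrightarrow> rank A y \<le> x \<and> x < rank A z" (is "?L \<longleftrightarrow> ?R")
proof
  assume ?L
  then show ?R
    using mono_rank[of y _ A] rank_less_iff[of _ A z] by auto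
next
  assume ?R
  then obtain a where a: "a \<in> A" "a < z" "rank A a = x"
    using ex_rank_eq_iff[of A z x] by auto
  moreover have "\<not> a < y"
    using a \<open>?R\<close> rank_less_iff[of a A y] by auto
  ultimately show ?L by (metis not_less)
qed

text \<open>Membership of \<open>y\<close> is the increment of the rank from \<open>y\<close> to
  \<open>Suc y\<close>.\<close>

lemma rank_determines_set:
  assumes "\<And>y. y \<le> Suc n \<Longrightarrow> rank A y = rank A' y" "A \<subseteq> {..n}" "A' \<subseteq> {..n}"
  shows "A = A'"
proof -
  have "y \<in> A \<longleftrightarrow> y \<in> A'" if "y \<le> n" for y
    using assms(1)[of y] assms(1)[of "Suc y"] that by (simp add: rank_Suc split: if_splits)
  then show ?thesis
    using assms(2,3) by auto
qed

lemma rank_insert_0: "0 \<notin> A \<Longrightarrow> rank (insert 0 A) y = (if y = 0 then 0 else Suc (rank A y))"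
  by (induction y) (auto simp: rank_Suc)

lemma rank_insert_ge: "y \<le> a \<Longrightarrow> rank (insert a A) y = rank A y"
  by (induction y) (auto simp: rank_Suc)

section \<open>Increasing maps between sets of natural numbers\<close>

lemma rank_strict_mono_image:
  assumes "strict_mono_on A f" "a \<in> A"
  shows "rank (f ` A) (f a) = rank A a"
proof -
  have "f ` A \<inter> {..<f a} = f ` (A \<inter> {..<a})"
    using assms by (auto simp: strict_mono_on_less)
  moreover have "inj_on f (A \<inter> {..<a})"
    using assms(1) strict_mono_on_imp_inj_on inj_on_subset by blast
  ultimately show ?thesis
    by (simp add: rank_def card_image)
qed

text \<open>Increasing maps preserve ranks, so both values have the same rank in the common
  image.\<close>

lemma strict_mono_on_unique:
  fixes f g :: "nat \<Rightarrow> nat"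
  assumes "strict_mono_on A f" "strict_mono_on A g" "f ` A = g ` A" "a \<in> A"
  shows "f a = g a"
proof -
  have "rank (f ` A) (f a) = rank (f ` A) (g a)"
    using rank_strict_mono_image[OF assms(1,4)] rank_strict_mono_image[OF assms(2,4)] assms(3) by simp
  then show ?thesis
    using rank_inject[of "f a" "f ` A" "g a"] assms(3,4) by auto
qed

text \<open>Undo the increasing enumeration of \<open>A\<close>, then apply that of
  \<open>B\<close>.\<close>

lemma ex_strict_mono_on_image:
  fixes A B :: "nat set"
  assumes "finite A" "finite B" "card A = card B"
  shows "\<exists>f. strict_mono_on A f \<and> f ` A = B"
proof -
  obtain g where g: "bij_betw g {..<card A} A" "strict_mono_on {..<card A} g"
    using ex_bij_betw_strict_mono_card[OF assms(1)] by blast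
  obtain h where h: "bij_betw h {..<card B} B" "strict_mono_on {..<card B} h"
    using ex_bij_betw_strict_mono_card[OF assms(2)] by blast
  define g' where "g' = inv_into {..<card A} g"
  have g': "bij_betw g' A {..<card A}"
    using g(1) bij_betw_inv_into unfolding g'_def by blast
  have "g' x < g' y" if "x \<in> A" "y \<in> A" "x < y" for x y
  proof -
    have "g (g' x) = x" "g (g' y) = y"
      using that g(1) unfolding g'_def by (auto simp: bij_betw_def f_inv_into_f)
    moreover have "g' x \<in> {..<card A}" "g' y \<in> {..<card A}"
      using g' that by (auto dest: bij_betwE)
    ultimately show ?thesis
      using that(3) strict_mono_on_less[OF g(2)] by metis
  qed
  then have "strict_mono_on A (h \<circ> g')"
    using h(2) g' assms(3) unfolding strict_mono_on_def by (auto dest!: bij_betwE)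
  moreover have "(h \<circ> g') ` A = B"
    using h(1) g' assms(3) by (metis bij_betw_imp_surj_on image_comp)
  ultimately show ?thesis by blast
qed

section \<open>Bi-increasing permutations\<close>

lemma excedances_permutes:
  assumes "p permutes {1..n}"
  shows "excedances n p = {i \<in> {1..n}. i < p i}"
proof -
  have "i \<le> n - 1" if "i \<in> {1..n}" "i < p i" for i
    using permutes_in_image[OF assms, of i] that by auto
  then show ?thesis
    unfolding excedances_def by auto
qed

lemma excedances_subset: "p permutes {1..n} \<Longrightarrow> excedances n p \<subseteq> {1..n}"
  by (auto simp: excedances_permutes)

text \<open>Inversions are grouped by first position. At an excedance \<open>i\<close>, comparing
  the positions before \<open>i\<close> with the values below \<open>p i\<close> trades later
  smaller entries for earlier larger ones, at the cost \<open>p i - i\<close>.\<close>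

lemma inv_number_eq:
  assumes p: "p permutes {1..n}"
  shows "inv_number n p = dexc n p
    + (\<Sum>i\<in>excedances n p. card {j. 1 \<le> j \<and> j < i \<and> p j > p i})
    + (\<Sum>i\<in>{1..n} - excedances n p. card {j. i < j \<and> j \<le> n \<and> p j < p i})"
    (is "_ = _ + (\<Sum>i\<in>_. card (?D i)) + (\<Sum>i\<in>_. card (?R i))")
proof -
  have ex: "excedances n p = {i \<in> {1..n}. i < p i}"
    using excedances_permutes[OF p] .
  have inj: "inj p"
    using permutes_inj[OF p] .
  \<comment> \<open>Eliminate \<open>card L\<close> from two counts: positions before
    \<open>i\<close> split into \<open>L\<close> and \<open>?D i\<close>, values below
    \<open>p i\<close> into the images of \<open>L\<close> and \<open>?R i\<close>. The additive
    form avoids truncated subtraction when \<open>p i < i\<close>.\<close>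
  have key: "card (?R i) + i = p i + card (?D i)" if i: "i \<in> {1..n}" for i
  proof -
    define L where "L = {j. 1 \<le> j \<and> j < i \<and> p j < p i}"
    have pi: "p i \<in> {1..n}"
      using permutes_in_image[OF p, of i] i by auto
    have fin: "finite L" "finite (?D i)" "finite (?R i)"
      unfolding L_def by (auto intro: finite_subset[of _ "{..n}"] finite_subset[of _ "{..<i}"])
    have "L \<union> ?D i = {1..<i}"
      using inj unfolding L_def by (auto simp: inj_eq) (metis inj_eq less_irrefl nat_neq_iff)
    then have "card (L \<union> ?D i) = i - 1" by simp
    then have 1: "card L + card (?D i) = i - 1"
      by (subst (asm) card_Un_disjoint) (use fin in \<open>auto simp: L_def\<close>)
    have "p ` (L \<union> ?R i) = {1..<p i}"
    proof (intro equalityI subsetI)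
      fix v assume "v \<in> p ` (L \<union> ?R i)"
      then obtain j where j: "v = p j" "j \<in> {1..n}" "p j < p i"
        using i unfolding L_def by auto
      then show "v \<in> {1..<p i}"
        using permutes_in_image[OF p, of j] by auto
    next
      fix v assume v: "v \<in> {1..<p i}"
      then have "v \<in> p ` {1..n}"
        using pi permutes_image[OF p] by auto
      then obtain j where j: "j \<in> {1..n}" "v = p j" by auto
      then have "j \<noteq> i" using v by auto
      then have "j \<in> L \<union> ?R i"
        using j v unfolding L_def by auto
      then show "v \<in> p ` (L \<union> ?R i)" using j by blast
    qed
    then have "card (p ` (L \<union> ?R i)) = p i - 1" by simp
    then have "card (L \<union> ?R i) = p i - 1"
      using card_image inj inj_on_subset by (metis subset_UNIV)
    then have 2: "card L + card (?R i) = p i - 1"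
      by (subst (asm) card_Un_disjoint) (use fin in \<open>auto simp: L_def\<close>)
    show ?thesis
      using 1 2 i pi by auto
  qed
  have "{(i, j). 1 \<le> i \<and> i < j \<and> j \<le> n \<and> p i > p j} = (SIGMA i:{1..n}. ?R i)"
    by auto
  then have "inv_number n p = (\<Sum>i\<in>{1..n}. card (?R i))"
    unfolding inv_number_def by (simp add: card_SigmaI)
  also have "\<dots> = (\<Sum>i\<in>excedances n p. card (?R i)) + (\<Sum>i\<in>{1..n} - excedances n p. card (?R i))"
    using sum.subset_diff[OF excedances_subset[OF p], of "\<lambda>i. card (?R i)"]
    by (simp add: add.commute)
  also have "(\<Sum>i\<in>excedances n p. card (?R i)) = (\<Sum>i\<in>excedances n p. (p i - i) + card (?D i))"
  proof (rule sum.cong[OF refl])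
    fix i assume "i \<in> excedances n p"
    then have "i \<in> {1..n}" "i < p i" using ex by auto
    then show "card (?R i) = (p i - i) + card (?D i)"
      using key[of i] by linarith
  qed
  finally show ?thesis
    by (simp add: dexc_def sum.distrib)
qed

text \<open>Equality with \<open>dexc\<close> means that both correction sums of
  \<open>inv_number_eq\<close> vanish. Inversions between the two classes never enter these sums, so
  only order within each class matters.\<close>

lemma bi_increasing_iff:
  "bi_increasing n p \<longleftrightarrow> p permutes {1..n} \<and>
     strict_mono_on (excedances n p) p \<and> strict_mono_on ({1..n} - excedances n p) p"
proof (cases "p permutes {1..n}")
  case True
  note p = this
  let ?E = "excedances n p"
  let ?D = "\<lambda>i. {j. 1 \<le> j \<and> j < i \<and> p j > p i}" and ?R = "\<lambda>i. {j. i < j \<and> j \<le> n \<and> p j < p i}"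
  have ex: "?E = {i \<in> {1..n}. i < p i}"
    using excedances_permutes[OF p] .
  then have finE: "finite ?E" by simp
  have fin: "finite (?D i)" "finite (?R i)" for i
    by (auto intro: finite_subset[of _ "{..n}"] finite_subset[of _ "{..<i}"])
  have "bi_increasing n p \<longleftrightarrow> (\<forall>i\<in>?E. ?D i = {}) \<and> (\<forall>i\<in>{1..n} - ?E. ?R i = {})"
    unfolding bi_increasing_def inv_number_eq[OF p] using p fin finE
    by (simp only: simp_thms add.assoc add_cancel_left_right add_is_0 sum_eq_0_iff finite_Diff
      finite_atLeastAtMost card_0_eq)
  also have "\<dots> \<longleftrightarrow> strict_mono_on ?E p \<and> strict_mono_on ({1..n} - ?E) p"
  proof (intro iffI conjI ballI)
    assume *: "(\<forall>i\<in>?E. ?D i = {}) \<and> (\<forall>i\<in>{1..n} - ?E. ?R i = {})"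
    have less: "p i < p j" if "\<not> p j < p i" "i < j" for i j
      using permutes_inj[OF p] that by (metis inj_eq less_irrefl nat_neq_iff)
    show "strict_mono_on ?E p"
    proof (rule strict_mono_onI)
      fix i j assume "i \<in> ?E" "j \<in> ?E" "i < j"
      then show "p i < p j"
        using * ex by (intro less) auto
    qed
    show "strict_mono_on ({1..n} - ?E) p"
    proof (rule strict_mono_onI)
      fix i j assume "i \<in> {1..n} - ?E" "j \<in> {1..n} - ?E" "i < j"
      then show "p i < p j"
        using * by (intro less) auto
    qed
  next
    fix i assume *: "strict_mono_on ?E p \<and> strict_mono_on ({1..n} - ?E) p" and i: "i \<in> ?E"
    have False if j: "j \<in> ?D i" for j
    proof (cases "j \<in> ?E")
      case True
      then show False
        using * i j strict_mono_onD[of ?E p j i] by auto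
    next
      \<comment> \<open>Here \<open>p j \<le> j < i < p i\<close>, contradicting
        \<open>p j > p i\<close>.\<close>
      case False
      then show False
        using i j ex by auto
    qed
    then show "?D i = {}" by blast
  next
    fix i assume *: "strict_mono_on ?E p \<and> strict_mono_on ({1..n} - ?E) p" and i: "i \<in> {1..n} - ?E"
    have False if j: "j \<in> ?R i" for j
    proof (cases "j \<in> ?E")
      \<comment> \<open>Here \<open>p i \<le> i < j < p j\<close>, contradicting
        \<open>p j < p i\<close>.\<close>
      case True
      then show False
        using i j ex by auto
    next
      case False
      then show False
        using * i j strict_mono_onD[of "{1..n} - ?E" p i j] by auto
    qed
    then show "?R i = {}" by blast
  qed
  finally show ?thesis
    using p by simp
qed (simp add: bi_increasing_def)

text \<open>The rank inequality is the elementwise comparison of \<open>B\<close> and \<open>T\<close>, stated by counting instead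
  of by sorting.\<close>

definition dominated_pairs :: "nat \<Rightarrow> nat \<Rightarrow> nat \<Rightarrow> (nat set \<times> nat set) set" where
  "dominated_pairs n e k = {(B, T). B \<subseteq> {1..n} \<and> T \<subseteq> {1..n} \<and> card B = e \<and> card T = e \<and>
     (\<forall>y. rank T (Suc y) \<le> rank B y) \<and>
     (\<Sum>y\<le>n. rank B (Suc y) - rank T (Suc y)) = k}"

section \<open>Excedance positions and values as a dominated pair\<close>

lemma rank_image_excedances:
  assumes p: "p permutes {1..n}"
  shows "rank (p ` excedances n p) y = card {i \<in> excedances n p. p i < y}"
proof -
  have "p ` excedances n p \<inter> {..<y} = p ` {i \<in> excedances n p. p i < y}" by auto
  moreover have "inj_on p {i \<in> excedances n p. p i < y}"
    using permutes_inj[OF p] inj_on_subset by blast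
  ultimately show ?thesis
    unfolding rank_def using card_image by metis
qed

text \<open>An excedance with value at most \<open>y\<close> has position below \<open>y\<close>.
  Removing these from the excedances up to \<open>y\<close> leaves those straddling row
  \<open>y\<close>.\<close>

lemma rank_excedances:
  assumes p: "p permutes {1..n}"
  shows "rank (p ` excedances n p) (Suc y) \<le> rank (excedances n p) y"
    and "rank (excedances n p) (Suc y) - rank (p ` excedances n p) (Suc y)
      = card {i \<in> excedances n p. i \<le> y \<and> y < p i}"
proof -
  let ?E = "excedances n p"
  have ex: "?E = {i \<in> {1..n}. i < p i}"
    using excedances_permutes[OF p] .
  show "rank (p ` ?E) (Suc y) \<le> rank ?E y"
    unfolding rank_image_excedances[OF p] unfolding rank_def ex by (intro card_mono) auto
  have "{i \<in> ?E. i \<le> y \<and> y < p i} = (?E \<inter> {..<Suc y}) - {i \<in> ?E. p i < Suc y}"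
    by auto
  moreover have "{i \<in> ?E. p i < Suc y} \<subseteq> ?E \<inter> {..<Suc y}"
    unfolding ex by auto
  moreover have "finite {i \<in> ?E. p i < Suc y}"
    unfolding ex by simp
  ultimately show "rank ?E (Suc y) - rank (p ` ?E) (Suc y) = card {i \<in> ?E. i \<le> y \<and> y < p i}"
    unfolding rank_image_excedances[OF p] unfolding rank_def by (simp add: card_Diff_subset)
qed

text \<open>Double counting of pairs \<open>(i, y)\<close> with \<open>i \<le> y < p i\<close>: an
  excedance \<open>i\<close> straddles \<open>p i - i\<close> rows.\<close>

lemma dexc_eq_sum_rank:
  assumes p: "p permutes {1..n}"
  shows "(\<Sum>y\<le>n. rank (excedances n p) (Suc y) - rank (p ` excedances n p) (Suc y)) = dexc n p"
proof -
  let ?E = "excedances n p"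
  have ex: "?E = {i \<in> {1..n}. i < p i}"
    using excedances_permutes[OF p] .
  then have finE: "finite ?E" by simp
  have "(\<Sum>y\<le>n. rank ?E (Suc y) - rank (p ` ?E) (Suc y)) = (\<Sum>y\<le>n. card {i \<in> ?E. i \<le> y \<and> y < p i})"
    by (simp add: rank_excedances(2)[OF p])
  also have "\<dots> = (\<Sum>y\<le>n. \<Sum>i\<in>?E. if i \<le> y \<and> y < p i then 1 else 0)"
    using finE by (simp flip: sum.inter_filter)
  also have "\<dots> = (\<Sum>i\<in>?E. \<Sum>y\<le>n. if i \<le> y \<and> y < p i then 1 else 0)"
    by (rule sum.swap)
  also have "\<dots> = (\<Sum>i\<in>?E. p i - i)"
  proof (rule sum.cong[OF refl])
    fix i assume "i \<in> ?E"
    then have "p i \<le> n"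
      using permutes_in_image[OF p, of i] ex by auto
    then have "{y \<in> {..n}. i \<le> y \<and> y < p i} = {i..<p i}" by auto
    then show "(\<Sum>y\<le>n. if i \<le> y \<and> y < p i then 1 else 0) = p i - i"
      by (simp flip: sum.inter_filter)
  qed
  finally show ?thesis
    by (simp add: dexc_def)
qed

text \<open>The two sets fix the domain and image of both increasing pieces, since a permutation
  sends complements to complements.\<close>

lemma inj_on_excedances:
  "inj_on (\<lambda>p. (excedances n p, p ` excedances n p)) {p. bi_increasing n p}"
proof (rule inj_onI, clarify)
  fix p q assume p: "bi_increasing n p" and q: "bi_increasing n q"
    and E: "excedances n p = excedances n q" and T: "p ` excedances n p = q ` excedances n q"
  let ?E = "excedances n q"
  have perm: "p permutes {1..n}" "q permutes {1..n}"
    using p q by (auto simp: bi_increasing_iff)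
  have "r ` ({1..n} - ?E) = {1..n} - r ` ?E" if "r permutes {1..n}" for r
    using permutes_image[OF that] permutes_inj[OF that] by (metis image_set_diff)
  then have T': "p ` ({1..n} - ?E) = q ` ({1..n} - ?E)"
    using perm T E by metis
  show "p = q"
  proof
    fix i
    consider "i \<in> ?E" | "i \<in> {1..n} - ?E" | "i \<notin> {1..n}" by auto
    then show "p i = q i"
    proof cases
      case 1
      with p q E T show ?thesis
        by (intro strict_mono_on_unique[of ?E]) (auto simp: bi_increasing_iff)
    next
      case 2
      with p q E T' show ?thesis
        by (intro strict_mono_on_unique[of "{1..n} - ?E"]) (auto simp: bi_increasing_iff)
    next
      case 3
      with perm show ?thesis by (simp add: permutes_def)
    qed
  qed
qed

section \<open>Reconstruction of a bi-increasing permutation\<close>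

lemma rank_Compl:
  assumes "B \<subseteq> {1..n}" "y \<le> Suc n"
  shows "rank ({1..n} - B) y + rank B y = y - 1"
  using assms(2)
proof (induction y)
  case (Suc y)
  then show ?case
    using assms(1) by (cases "y = 0") (auto simp: rank_Suc)
qed simp

text \<open>Glue the increasing bijections \<open>B\<close> to \<open>T\<close> and complement to
  complement. Domination then makes \<open>B\<close> exactly the excedance set.\<close>

lemma ex_bi_increasing:
  assumes B: "B \<subseteq> {1..n}" and T: "T \<subseteq> {1..n}" and card: "card B = card T"
    and dom: "\<And>y. rank T (Suc y) \<le> rank B y"
  obtains p where "bi_increasing n p" "excedances n p = B" "p ` B = T"
proof -
  let ?B' = "{1..n} - B" and ?T' = "{1..n} - T"
  have fin: "finite B" "finite T"
    using B T finite_subset by blast+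
  obtain f where f: "strict_mono_on B f" "f ` B = T"
    using ex_strict_mono_on_image[OF fin card] by blast
  have "card ?B' = card ?T'"
    using B T card fin by (simp add: card_Diff_subset)
  then obtain g where g: "strict_mono_on ?B' g" "g ` ?B' = ?T'"
    using ex_strict_mono_on_image[of ?B' ?T'] by auto
  define p where "p = (\<lambda>i. if i \<in> B then f i else if i \<in> {1..n} then g i else i)"
  have pB: "strict_mono_on B p" "p ` B = T"
    using f unfolding p_def by (auto simp: strict_mono_on_def)
  have pB': "strict_mono_on ?B' p" "p ` ?B' = ?T'"
    using g unfolding p_def by (auto simp: strict_mono_on_def)
  have img: "p ` {1..n} = {1..n}"
  proof -
    have "p ` {1..n} = p ` B \<union> p ` ?B'" using B by blast
    then show ?thesis using pB pB' T by blast
  qed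
  have "bij_betw p {1..n} {1..n}"
    using img eq_card_imp_inj_on[of "{1..n}" p] by (simp add: bij_betw_def)
  then have perm: "p permutes {1..n}"
    using B by (intro bij_imp_permutes) (auto simp: p_def)
  \<comment> \<open>The rank of \<open>i\<close> in \<open>B\<close> equals that of
    \<open>p i\<close> in \<open>T\<close>; domination at \<open>p i\<close> turns this into a
    strict rank comparison inside \<open>B\<close>.\<close>
  have up: "i < p i" if i: "i \<in> B" for i
  proof -
    have pT: "p i \<in> T" using pB i by auto
    have "rank B i < rank T (Suc (p i))"
      using rank_strict_mono_image[OF pB(1) i] pB(2) pT by (simp add: rank_Suc)
    also have "\<dots> \<le> rank B (p i)" by (rule dom)
    finally show ?thesis
      using rank_less_iff[OF i] by simp
  qed
  \<comment> \<open>Complementation reverses domination. As \<open>i\<close> is not in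
    \<open>B\<close>, the ranks of \<open>B\<close> at \<open>i\<close> and \<open>Suc i\<close>
    agree, which yields the strict inequality for the complements.\<close>
  have down: "p i \<le> i" if i: "i \<in> ?B'" for i
  proof -
    have pT: "p i \<in> ?T'" using pB' i by auto
    have "rank ?B' (Suc i) + rank B (Suc i) = i" "rank ?T' (Suc i) + rank T (Suc i) = i"
      using rank_Compl[OF B, of "Suc i"] rank_Compl[OF T, of "Suc i"] i by auto
    moreover have "rank B (Suc i) = rank B i" "rank ?B' (Suc i) = Suc (rank ?B' i)"
      using i by (auto simp: rank_Suc)
    ultimately have "rank ?B' i < rank ?T' (Suc i)"
      using dom[of i] by linarith
    then have "rank ?T' (p i) < rank ?T' (Suc i)"
      using rank_strict_mono_image[OF pB'(1) i] pB'(2) by simp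
    then show ?thesis
      using rank_less_iff[OF pT] by simp
  qed
  have ex: "excedances n p = B"
    unfolding excedances_permutes[OF perm] using up down B by (fastforce simp: not_less)
  then have "bi_increasing n p"
    using perm pB pB' by (simp add: bi_increasing_iff)
  then show thesis
    using that ex pB by blast
qed

lemma bij_betw_excedances:
  "bij_betw (\<lambda>p. (excedances n p, p ` excedances n p))
     {p. bi_increasing n p \<and> exc n p = e \<and> dexc n p = k} (dominated_pairs n e k)"
proof (rule bij_betw_imageI)
  show "inj_on (\<lambda>p. (excedances n p, p ` excedances n p))
    {p. bi_increasing n p \<and> exc n p = e \<and> dexc n p = k}"
    by (rule inj_on_subset[OF inj_on_excedances]) auto
next
  show "(\<lambda>p. (excedances n p, p ` excedances n p)) `
    {p. bi_increasing n p \<and> exc n p = e \<and> dexc n p = k} = dominated_pairs n e k"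
  proof (intro equalityI subsetI)
    fix z assume "z \<in> (\<lambda>p. (excedances n p, p ` excedances n p)) `
      {p. bi_increasing n p \<and> exc n p = e \<and> dexc n p = k}"
    then obtain p where z: "z = (excedances n p, p ` excedances n p)"
      and p: "p permutes {1..n}" "exc n p = e" "dexc n p = k"
      by (auto simp: bi_increasing_def)
    have "inj_on p (excedances n p)"
      using permutes_inj[OF p(1)] inj_on_subset by blast
    then have "card (p ` excedances n p) = e"
      using p(2) by (simp add: card_image exc_def)
    moreover have "excedances n p \<subseteq> {1..n}"
      using excedances_permutes[OF p(1)] by auto
    moreover from this have "p ` excedances n p \<subseteq> {1..n}"
      using permutes_image[OF p(1)] by blast
    ultimately show "z \<in> dominated_pairs n e k"
      using p rank_excedances(1)[OF p(1)] dexc_eq_sum_rank[OF p(1)]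
      unfolding z dominated_pairs_def exc_def by simp
  next
    fix z assume "z \<in> dominated_pairs n e k"
    then obtain B T where z: "z = (B, T)" and BT: "B \<subseteq> {1..n}" "T \<subseteq> {1..n}" "card B = e" "card T = e"
      "\<And>y. rank T (Suc y) \<le> rank B y" "(\<Sum>y\<le>n. rank B (Suc y) - rank T (Suc y)) = k"
      unfolding dominated_pairs_def by auto
    obtain p where p: "bi_increasing n p" "excedances n p = B" "p ` B = T"
      using ex_bi_increasing[of B n T] BT by metis
    then have "p permutes {1..n}" by (simp add: bi_increasing_def)
    then have "dexc n p = k" "exc n p = e"
      using dexc_eq_sum_rank p BT by (auto simp: exc_def)
    then show "z \<in> (\<lambda>p. (excedances n p, p ` excedances n p)) `
      {p. bi_increasing n p \<and> exc n p = e \<and> dexc n p = k}"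
      using p z by blast
  qed
qed

section \<open>Step polyominoes\<close>

text \<open>A path of height \<open>h\<close> without consecutive east steps is determined by the set \<open>Y\<close> of
  heights at which it has an east step.\<close>

primrec staircase :: "nat set \<Rightarrow> nat \<Rightarrow> lattice_path" where
  "staircase Y 0 = (if 0 \<in> Y then [East] else [])"
| "staircase Y (Suc h) =
     (if Suc h \<in> Y then (staircase Y h @ [North]) @ [East] else staircase Y h @ [North])"

lemma staircase_cong:
  "(\<And>y. y \<le> h \<Longrightarrow> y \<in> Y \<longleftrightarrow> y \<in> Y') \<Longrightarrow> staircase Y h = staircase Y' h"
  by (induction h) auto

text \<open>\<open>Suc h\<close> rather than \<open>h\<close>, because an east step at the final
  height \<open>h\<close> belongs to the path.\<close>

lemma end_point_staircase: "end_point (staircase Y h) = (rank Y (Suc h), h)"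
  by (induction h) (auto simp: end_point_def rank_Suc)

lemma path_points_Nil: "path_points [] = {(0, 0)}"
  by (simp add: path_points_def end_point_def)

lemma path_points_snoc: "path_points (w @ [s]) = insert (end_point (w @ [s])) (path_points w)"
proof -
  have "path_points w = (\<lambda>m. end_point (take m w)) ` {..length w}" for w
    unfolding path_points_def by auto
  moreover have "(\<lambda>m. end_point (take m (w @ [s]))) ` {..length w} = (\<lambda>m. end_point (take m w)) ` {..length w}"
    by (intro image_cong) auto
  ultimately show ?thesis
    by (simp add: atMost_Suc)
qed

lemma path_points_staircase:
  "path_points (staircase Y h) = {(x, y). y \<le> h \<and> rank Y y \<le> x \<and> x \<le> rank Y (Suc y)}"
proof (induction h)
  case 0
  have "path_points [East] = {(0, 0), (1, 0)}"
    using path_points_snoc[of "[]" East] by (simp add: path_points_Nil end_point_def insert_commute)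
  moreover have "{(x, y). y \<le> 0 \<and> rank Y y \<le> x \<and> x \<le> rank Y (Suc y)} = (\<lambda>x. (x, 0)) ` {..rank Y 1}"
    by auto
  ultimately show ?case
    by (simp add: rank_Suc path_points_Nil atMost_Suc insert_commute)
next
  case (Suc h)
  have "end_point (staircase Y h @ [North]) = (rank Y (Suc h), Suc h)"
    using end_point_staircase[of Y h] by (simp add: end_point_def)
  moreover have "end_point ((staircase Y h @ [North]) @ [East]) = (Suc (rank Y (Suc h)), Suc h)"
    using end_point_staircase[of Y h] by (simp add: end_point_def)
  ultimately have "path_points (staircase Y (Suc h)) = path_points (staircase Y h) \<union>
      {(x, y). y = Suc h \<and> rank Y (Suc h) \<le> x \<and> x \<le> rank Y (Suc (Suc h))}"
    unfolding staircase.simps rank_Suc[of Y "Suc h"]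
    by (cases "Suc h \<in> Y") (auto simp: path_points_snoc simp del: append_assoc)
  then show ?case
    unfolding Suc by (auto simp: le_Suc_eq)
qed

lemma east_step_at_snoc:
  "east_step_at (w @ [s]) x y \<longleftrightarrow> east_step_at w x y \<or> (s = East \<and> end_point w = (x, y))"
proof -
  let ?Q = "\<lambda>m. (w @ [s]) ! m = East \<and> end_point (take m (w @ [s])) = (x, y)"
  have "(\<exists>m < Suc (length w). ?Q m) \<longleftrightarrow> (\<exists>m < length w. ?Q m) \<or> ?Q (length w)"
    unfolding less_Suc_eq by blast
  moreover have "(\<exists>m < length w. ?Q m) \<longleftrightarrow> (\<exists>m < length w. w ! m = East \<and> end_point (take m w) = (x, y))"
    by (simp add: nth_append cong: conj_cong)
  ultimately show ?thesis
    unfolding east_step_at_def by simp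
qed

lemma east_step_at_staircase:
  "east_step_at (staircase Y h) x y \<longleftrightarrow> y \<le> h \<and> y \<in> Y \<and> rank Y y = x"
proof (induction h)
  case 0
  show ?case
    by (auto simp: east_step_at_def end_point_def)
next
  case (Suc h)
  have "end_point (staircase Y h @ [North]) = (rank Y (Suc h), Suc h)"
    using end_point_staircase[of Y h] by (simp add: end_point_def)
  then show ?case
    using Suc by (auto simp: east_step_at_snoc le_Suc_eq simp del: append_assoc)
qed

lemma no_consecutive_easts_snoc:
  "no_consecutive_easts (w @ [s]) \<longleftrightarrow>
     no_consecutive_easts w \<and> \<not> (s = East \<and> w \<noteq> [] \<and> last w = East)"
proof -
  have "(\<exists>m. m + 1 < length (w @ [s]) \<and> (w @ [s]) ! m = East \<and> (w @ [s]) ! (m + 1) = East) \<longleftrightarrow>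
    (\<exists>m. m + 1 < length w \<and> w ! m = East \<and> w ! (m + 1) = East) \<or>
    (\<exists>m. m + 1 = length w \<and> w ! m = East \<and> s = East)"
    (is "(\<exists>m. ?l m) \<longleftrightarrow> (\<exists>m. ?a m) \<or> (\<exists>m. ?b m)")
  proof -
    have "?l m \<longleftrightarrow> ?a m \<or> ?b m" for m
      by (cases "m + 1 < length w"; cases "m + 1 = length w") (simp_all add: nth_append)
    then show ?thesis by blast
  qed
  also have "(\<exists>m. m + 1 = length w \<and> w ! m = East \<and> s = East) \<longleftrightarrow> s = East \<and> w \<noteq> [] \<and> last w = East"
    by (cases w rule: rev_cases) auto
  finally show ?thesis
    unfolding no_consecutive_easts_def by blast
qed

lemma last_staircase: "staircase Y h \<noteq> [] \<Longrightarrow> last (staircase Y h) = East \<longleftrightarrow> h \<in> Y"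
  by (cases h) auto

lemma no_consecutive_easts_staircase: "no_consecutive_easts (staircase Y h)"
proof (induction h)
  case 0
  show ?case by (simp add: no_consecutive_easts_def)
next
  case (Suc h)
  then show ?case
    by (simp add: no_consecutive_easts_snoc del: append_assoc)
qed

text \<open>Read the word from the left: a north step raises \<open>h\<close>, an east step inserts
  \<open>h\<close> into \<open>Y\<close>. The bound on \<open>Y\<close> keeps the new height free of
  east steps.\<close>

lemma ex_staircase:
  assumes "no_consecutive_easts w"
  shows "\<exists>Y h. Y \<subseteq> {..h} \<and> w = staircase Y h"
  using assms
proof (induction w rule: rev_induct)
  case Nil
  have "[] = staircase {} 0" by simp
  then show ?case by blast
next
  case (snoc s w)
  then obtain Y h where Y: "Y \<subseteq> {..h}" "w = staircase Y h"
    by (auto simp: no_consecutive_easts_snoc)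
  show ?case
  proof (cases s)
    case North
    have "Suc h \<notin> Y" using Y by auto
    then have "w @ [s] = staircase Y (Suc h)" using Y North by simp
    moreover have "Y \<subseteq> {..Suc h}" using Y by auto
    ultimately show ?thesis by blast
  next
    case East
    then have "w = [] \<or> last w \<noteq> East"
      using snoc.prems by (simp add: no_consecutive_easts_snoc)
    \<comment> \<open>A staircase with an east step at its top height would end in
      \<open>East\<close>, so inserting \<open>h\<close> records a new step.\<close>
    then have "h \<notin> Y"
      using Y last_staircase[of Y h] by (cases h) auto
    then have "w @ [s] = staircase (insert h Y) h"
      using Y East staircase_cong[of "h - 1" Y "insert h Y"] by (cases h) auto
    moreover have "insert h Y \<subseteq> {..h}" using Y by auto
    ultimately show ?thesis by blast
  qed
qed

text \<open>The arbitrary tail absorbs the steps that the recursion appends on the right; its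
  leading \<open>North\<close> supplies the head when the staircase is empty.\<close>

lemma hd_staircase: "hd (staircase Y h @ North # v) = (if 0 \<in> Y then East else North)"
  by (induction h arbitrary: v) auto

lemma hd_staircase_Suc: "hd (staircase Y (Suc h)) = (if 0 \<in> Y then East else North)"
  using hd_staircase[of Y h "[]"] hd_staircase[of Y h "[East]"] by simp

lemma staircase_Suc_neq_Nil: "staircase Y (Suc h) \<noteq> []"
  by simp

section \<open>Pairs of staircases bounding a polyomino\<close>

text \<open>Row \<open>y\<close> of the upper path occupies the abscissae from \<open>rank U y\<close> to \<open>rank U (Suc y)\<close>, and
  similarly for the lower path. Going up row by row, the upper path stays strictly to the left.\<close>

lemma boundary_pair_staircase_iff:
  "boundary_pair (staircase U (Suc n)) (staircase L (Suc n)) \<longleftrightarrow>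
     0 \<notin> U \<and> 0 \<in> L \<and> Suc n \<in> U \<and> Suc n \<notin> L \<and> rank U (Suc (Suc n)) = rank L (Suc (Suc n)) \<and>
     (\<forall>y. 1 \<le> y \<and> y \<le> n \<longrightarrow> rank U (Suc y) < rank L y)" (is "?P \<longleftrightarrow> ?Q")
proof
  assume ?P
  then have hd: "0 \<notin> U" "0 \<in> L" and W: "rank U (Suc (Suc n)) = rank L (Suc (Suc n))"
    and meet: "path_points (staircase U (Suc n)) \<inter> path_points (staircase L (Suc n)) =
      {(0, 0), (rank U (Suc (Suc n)), Suc n)}"
    unfolding boundary_pair_def hd_staircase_Suc end_point_staircase by (auto split: if_splits)
  have meetD: "(x, y) \<in> {(0, 0), (rank U (Suc (Suc n)), Suc n)}"
    if "y \<le> Suc n" "rank U y \<le> x" "x \<le> rank U (Suc y)" "rank L y \<le> x" "x \<le> rank L (Suc y)" for x y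
    unfolding meet[symmetric] path_points_staircase using that by auto
  \<comment> \<open>Otherwise \<open>(rank L y, y)\<close> would be a common point at a height
    strictly between \<open>0\<close> and \<open>Suc n\<close>.\<close>
  have step: "rank U (Suc y) < rank L y" if "1 \<le> y" "y \<le> n" "rank U y < rank L y" for y
  proof (rule ccontr)
    assume "\<not> ?thesis"
    then have "(rank L y, y) \<in> {(0, 0), (rank U (Suc (Suc n)), Suc n)}"
      using that by (intro meetD) (auto simp: mono_rank)
    then show False using that by auto
  qed
  \<comment> \<open>At height \<open>0\<close> only the lower path moves east; \<open>step\<close>
    carries the strict gap upwards.\<close>
  have left: "rank U (Suc y) < rank L (Suc y)" if "y \<le> n" for y
    using that
  proof (induction y)
    case 0
    then show ?case using hd by (simp add: rank_Suc)
  next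
    case (Suc y)
    then show ?case
      using step[of "Suc y"] mono_rank[of "Suc y" "Suc (Suc y)" L] by simp
  qed
  have rows: "\<forall>y. 1 \<le> y \<and> y \<le> n \<longrightarrow> rank U (Suc y) < rank L y"
  proof (intro allI impI)
    fix y assume y: "1 \<le> y \<and> y \<le> n"
    then show "rank U (Suc y) < rank L y"
      using step[of y] left[of "y - 1"] by (cases y) auto
  qed
  \<comment> \<open>At most one east step fits into the top row. Closing the remaining gap therefore
    forces one on the upper path and none on the lower path.\<close>
  have "rank U (Suc n) < rank L (Suc n)"
    using left by simp
  moreover have "rank L (Suc n) \<le> rank L (Suc (Suc n))"
    by (rule mono_rank) simp
  moreover have "rank U (Suc (Suc n)) \<le> Suc (rank U (Suc n))"
    using rank_Suc[of U "Suc n"] by simp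
  ultimately have "rank U (Suc (Suc n)) = Suc (rank U (Suc n))" "rank L (Suc (Suc n)) = rank L (Suc n)"
    using W by linarith+
  then have "Suc n \<in> U" "Suc n \<notin> L"
    using rank_Suc[of U "Suc n"] rank_Suc[of L "Suc n"] by (auto split: if_splits)
  then show ?Q
    using hd W rows by blast
next
  assume Q: ?Q
  let ?W = "rank U (Suc (Suc n))"
  have "(x, y) \<in> {(0, 0), (?W, Suc n)}"
    if y: "y \<le> Suc n" and x: "rank U y \<le> x" "x \<le> rank U (Suc y)" "rank L y \<le> x" "x \<le> rank L (Suc y)" for x y
  proof -
    consider "y = 0" | "1 \<le> y" "y \<le> n" | "y = Suc n"
      using y by linarith
    then show ?thesis
    proof cases
      case 1
      then show ?thesis using x Q by (simp add: rank_Suc)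
    next
      case 2
      then have "rank U (Suc y) < rank L y" using Q by blast
      then show ?thesis using x by linarith
    next
      case 3
      then have "rank L (Suc n) = ?W"
        using Q by (simp add: rank_Suc[of L "Suc n"])
      then show ?thesis using x 3 by simp
    qed
  qed
  moreover have "rank U (Suc n) \<le> ?W" "rank L (Suc n) \<le> ?W" "?W \<le> rank L (Suc (Suc n))"
    using Q mono_rank[of "Suc n" "Suc (Suc n)" U] mono_rank[of "Suc n" "Suc (Suc n)" L] by auto
  ultimately have "path_points (staircase U (Suc n)) \<inter> path_points (staircase L (Suc n)) = {(0, 0), (?W, Suc n)}"
    unfolding path_points_staircase by auto
  then show ?P
    using Q staircase_Suc_neq_Nil unfolding boundary_pair_def hd_staircase_Suc end_point_staircase by simp
qed

text \<open>The lower path gives the right bound of row \<open>y\<close>, the upper path the left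
  bound. The upper path also requires \<open>x\<close> to be below the total width, which follows
  from the right bound as the widths agree.\<close>

lemma cells_between_staircase:
  assumes "rank U (Suc (Suc n)) = rank L (Suc (Suc n))"
  shows "cells_between (staircase U (Suc n)) (staircase L (Suc n)) =
    {(x, y). y \<le> n \<and> rank U (Suc y) \<le> x \<and> x < rank L (Suc y)}"
proof -
  have "(\<exists>b. east_step_at (staircase L (Suc n)) x b \<and> b \<le> y) \<and>
      (\<exists>t. east_step_at (staircase U (Suc n)) x t \<and> y + 1 \<le> t) \<longleftrightarrow>
      y \<le> n \<and> rank U (Suc y) \<le> x \<and> x < rank L (Suc y)" (is "?l \<and> ?u \<longleftrightarrow> _") for x y
  proof -
    have u: "?u \<longleftrightarrow> rank U (Suc y) \<le> x \<and> x < rank U (Suc (Suc n))"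
      unfolding east_step_at_staircase ex_rank_eq_ge_iff[symmetric]
      by (auto simp: less_Suc_eq_le)
    have l: "?l \<longleftrightarrow> x < rank L (Suc y)" if "y \<le> n"
    proof -
      have "(b \<le> Suc n \<and> b \<in> L \<and> rank L b = x) \<and> b \<le> y \<longleftrightarrow> b \<in> L \<and> b < Suc y \<and> rank L b = x" for b
        using that by auto
      then show ?thesis
        unfolding east_step_at_staircase ex_rank_eq_iff[symmetric] Bex_def by simp
    qed
    have "rank L (Suc y) \<le> rank L (Suc (Suc n))" if "y \<le> n"
      using that by (intro mono_rank) simp
    moreover have "\<not> ?u" if "\<not> y \<le> n"
      using that unfolding east_step_at_staircase by auto
    ultimately show ?thesis
      using u l assms by (cases "y \<le> n") auto
  qed
  then show ?thesis
    unfolding cells_between_def by blast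
qed

section \<open>From dominated pairs to step polyominoes\<close>

text \<open>The closed right end accounts for the lower path's east step at height \<open>0\<close>,
  which adds one to the rank of \<open>B\<close>.\<close>

definition row_polyomino :: "nat \<Rightarrow> nat set \<times> nat set \<Rightarrow> (nat \<times> nat) set" where
  "row_polyomino n = (\<lambda>(B, T). {(x, y). y \<le> n \<and> rank T (Suc y) \<le> x \<and> x \<le> rank B (Suc y)})"

lemma card_row_polyomino:
  assumes "\<And>y. y \<le> n \<Longrightarrow> rank T (Suc y) \<le> rank B (Suc y)"
  shows "card (row_polyomino n (B, T)) = (\<Sum>y\<le>n. rank B (Suc y) - rank T (Suc y)) + n + 1"
proof -
  \<comment> \<open>Swapping the coordinates lets the cells be counted row by row.\<close>
  have "row_polyomino n (B, T) = prod.swap ` (SIGMA y:{..n}. {rank T (Suc y)..rank B (Suc y)})"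
    unfolding row_polyomino_def by force
  then have "card (row_polyomino n (B, T)) = (\<Sum>y\<le>n. Suc (rank B (Suc y)) - rank T (Suc y))"
    by (simp add: card_image)
  also have "\<dots> = (\<Sum>y\<le>n. (rank B (Suc y) - rank T (Suc y)) + 1)"
    using assms by (intro sum.cong) (auto simp: Suc_diff_le)
  finally show ?thesis
    by (simp only: sum.distrib) simp
qed

text \<open>Domination makes every row nonempty, so its end points can be read off; they are the
  ranks, which determine \<open>B\<close> and \<open>T\<close>.\<close>

lemma inj_on_row_polyomino: "inj_on (row_polyomino n) (dominated_pairs n e k)"
proof (rule inj_onI, clarify)
  fix B T B' T'
  assume d: "(B, T) \<in> dominated_pairs n e k" "(B', T') \<in> dominated_pairs n e k"
    and eq: "row_polyomino n (B, T) = row_polyomino n (B', T')"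
  have row: "rank T (Suc y) = rank T' (Suc y) \<and> rank B (Suc y) = rank B' (Suc y)" if "y \<le> n" for y
  proof -
    have "{x. (x, y) \<in> row_polyomino n (C, S)} = {rank S (Suc y)..rank C (Suc y)}" for C S
      using that unfolding row_polyomino_def by auto
    then have "{rank T (Suc y)..rank B (Suc y)} = {rank T' (Suc y)..rank B' (Suc y)}"
      using eq by metis
    moreover have "rank T (Suc y) \<le> rank B (Suc y)"
      using d(1) mono_rank[of y "Suc y" B] unfolding dominated_pairs_def by (auto intro: order_trans)
    ultimately show ?thesis
      by (simp add: Icc_eq_Icc)
  qed
  have sub: "B \<subseteq> {..n}" "T \<subseteq> {..n}" "B' \<subseteq> {..n}" "T' \<subseteq> {..n}"
    using d unfolding dominated_pairs_def by auto
  have "rank B y = rank B' y" "rank T y = rank T' y" if "y \<le> Suc n" for y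
    using row that by (cases y; simp)+
  then show "B = B' \<and> T = T'"
    using rank_determines_set sub by meson
qed

lemma row_polyomino_image:
  "row_polyomino n ` dominated_pairs n e k = step_polyominoes (e + 1) (n + 1) (k + n + 1)"
proof (intro equalityI subsetI)
  fix P assume "P \<in> row_polyomino n ` dominated_pairs n e k"
  then obtain B T where P: "P = row_polyomino n (B, T)" and BT: "B \<subseteq> {1..n}" "T \<subseteq> {1..n}"
      "card B = e" "card T = e" "\<And>y. rank T (Suc y) \<le> rank B y"
      "(\<Sum>y\<le>n. rank B (Suc y) - rank T (Suc y)) = k"
    unfolding dominated_pairs_def by auto
  \<comment> \<open>Every bounding pair has a lower east step at height \<open>0\<close> and an
    upper one at height \<open>Suc n\<close>; \<open>B\<close> and \<open>T\<close> record the
    others.\<close>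
  define U L where "U = insert (Suc n) T" and "L = insert 0 B"
  have U: "rank U y = rank T y" if "y \<le> Suc n" for y
    using that by (simp add: U_def rank_insert_ge)
  have L: "rank L y = (if y = 0 then 0 else Suc (rank B y))" for y
    using BT(1) unfolding L_def by (intro rank_insert_0) auto
  have e: "rank T (Suc n) = e" "rank B (Suc (Suc n)) = e"
    using BT rank_eq_card[of T "Suc n"] rank_eq_card[of B "Suc (Suc n)"] by fastforce+
  have W: "rank U (Suc (Suc n)) = e + 1" "rank L (Suc (Suc n)) = e + 1"
    using U[of "Suc n"] e L rank_Suc[of U "Suc n"] by (auto simp: U_def)
  have le: "rank T (Suc y) \<le> rank B (Suc y)" for y
    using BT(5)[of y] mono_rank[of y "Suc y" B] by simp
  have "boundary_pair (staircase U (Suc n)) (staircase L (Suc n))"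
    unfolding boundary_pair_staircase_iff using W BT(1,2,5) U L
    by (auto simp: U_def L_def less_Suc_eq_le)
  moreover have "P = cells_between (staircase U (Suc n)) (staircase L (Suc n))"
    unfolding cells_between_staircase[OF trans[OF W(1) W(2)[symmetric]]] P row_polyomino_def
    using U L by (auto simp: less_Suc_eq_le)
  moreover have "card P = k + n + 1"
    unfolding P using card_row_polyomino[of n T B] le BT(6) by simp
  moreover have "end_point (staircase U (Suc n)) = (e + 1, n + 1)"
    using W by (simp only: end_point_staircase) simp
  ultimately show "P \<in> step_polyominoes (e + 1) (n + 1) (k + n + 1)"
    unfolding step_polyominoes_def bounds_polyomino_def
    using no_consecutive_easts_staircase by blast
next
  fix P assume "P \<in> step_polyominoes (e + 1) (n + 1) (k + n + 1)"
  then obtain u l where ul: "boundary_pair u l" "P = cells_between u l" "no_consecutive_easts u"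
      "no_consecutive_easts l" "end_point u = (e + 1, n + 1)" "end_point l = (e + 1, n + 1)"
      "card P = k + n + 1"
    unfolding step_polyominoes_def bounds_polyomino_def boundary_pair_def by auto
  obtain U where U: "U \<subseteq> {..Suc n}" "u = staircase U (Suc n)" "rank U (Suc (Suc n)) = e + 1"
    using ex_staircase[OF ul(3)] ul(5) by (auto simp: end_point_staircase)
  obtain L where L: "L \<subseteq> {..Suc n}" "l = staircase L (Suc n)" "rank L (Suc (Suc n)) = e + 1"
    using ex_staircase[OF ul(4)] ul(6) by (auto simp: end_point_staircase)
  have bp: "0 \<notin> U" "0 \<in> L" "Suc n \<in> U" "Suc n \<notin> L"
      "\<And>y. 1 \<le> y \<Longrightarrow> y \<le> n \<Longrightarrow> rank U (Suc y) < rank L y"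
    using ul(1) unfolding U(2) L(2) boundary_pair_staircase_iff by blast+
  define B T where "B = L - {0}" and "T = U - {Suc n}"
  have interior: "A \<subseteq> {1..n}" if "A \<subseteq> {..Suc n}" "0 \<notin> A" "Suc n \<notin> A" for A
  proof
    fix x assume "x \<in> A"
    then have "x \<le> Suc n" using that by auto
    moreover have "x \<noteq> 0" "x \<noteq> Suc n" using that \<open>x \<in> A\<close> by metis+
    ultimately show "x \<in> {1..n}" by simp
  qed
  have BT: "B \<subseteq> {1..n}" "T \<subseteq> {1..n}"
    using U(1) L(1) bp(1-4) unfolding B_def T_def by (intro interior; auto)+
  have rU: "rank U y = rank T y" if "y \<le> Suc n" for y
    using that rank_insert_ge[of y "Suc n" T] bp by (simp add: T_def insert_absorb)
  have rL: "rank L y = (if y = 0 then 0 else Suc (rank B y))" for y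
    using rank_insert_0[of B y] bp by (simp add: B_def insert_absorb)
  have rank_T: "rank T y = card T" and rank_B: "rank B y = card B" if "n < y" for y
    using BT that by (auto intro!: rank_eq_card)
  have "rank T (Suc n) = e"
    using U(3) rU[of "Suc n"] bp by (simp add: rank_Suc[of U "Suc n"])
  then have cardT: "card T = e" using rank_T by simp
  have "rank B (Suc (Suc n)) = e"
    using L(3) rL by simp
  then have cardB: "card B = e" using rank_B by simp
  \<comment> \<open>Height \<open>0\<close> uses that \<open>T\<close> omits \<open>0\<close>. In
    between, the strict gap loses the one unit due to the lower step at \<open>0\<close>; above
    \<open>n\<close> both ranks equal \<open>e\<close>.\<close>
  have dom: "rank T (Suc y) \<le> rank B y" for y
  proof -
    consider "y = 0" | "1 \<le> y" "y \<le> n" | "n < y" by linarith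
    then show ?thesis
    proof cases
      case 1
      then show ?thesis using BT by (auto simp: rank_Suc)
    next
      case 2
      then show ?thesis using bp(5)[of y] rU[of "Suc y"] rL[of y] by simp
    next
      case 3
      then show ?thesis using rank_T rank_B cardT cardB by simp
    qed
  qed
  then have le: "rank T (Suc y) \<le> rank B (Suc y)" for y
    using mono_rank[of y "Suc y" B] order_trans by simp blast
  have P: "P = row_polyomino n (B, T)"
    unfolding ul(2) U(2) L(2) cells_between_staircase[OF trans[OF U(3) L(3)[symmetric]]] row_polyomino_def
    using rU rL by (auto simp: less_Suc_eq_le)
  then have "(\<Sum>y\<le>n. rank B (Suc y) - rank T (Suc y)) = k"
    using card_row_polyomino[of n T B] le ul(7) by simp
  then have "(B, T) \<in> dominated_pairs n e k"
    unfolding dominated_pairs_def using BT cardT cardB dom by auto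
  then show "P \<in> row_polyomino n ` dominated_pairs n e k"
    using P by blast
qed

theorem theorem3p1:
  fixes n e k :: nat
  assumes "n \<ge> 1"
  shows "\<exists>f. bij_betw f
           {p. bi_increasing n p \<and> exc n p = e \<and> dexc n p = k}
           (step_polyominoes (e + 1) (n + 1) (k + n + 1))"
proof -
  have "bij_betw (row_polyomino n) (dominated_pairs n e k) (step_polyominoes (e + 1) (n + 1) (k + n + 1))"
    using inj_on_row_polyomino row_polyomino_image by (intro bij_betw_imageI)
  then show ?thesis
    using bij_betw_trans[OF bij_betw_excedances] by blast
qed

end
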